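(* Let $\mathcal{F}_s$, $\{\mathcal{F}_d^i\}_{i=1}^M$ and $\mathcal{C}$ be given, let $P_1,\dots,P_M$ be the induced joint distributions of (shared feature, label prediction) pairs $(f,c)$ in the $M$ domains, identified with their densities with respect to a common $\sigma$-finite reference measure, and let $$\widetilde{P}(f,c)=\frac{\sum_{i=1}^M P_i(f,c)}{M}.$$ Let $\mathcal{D}^*$ be the optimum conditional domain discriminator, i.e. the minimizer of $$\mathcal{J}_{\mathcal{D}} = -\sum_{i=1}^M \mathbb{E}_{(f,c)\sim P_i}\big[\log \mathcal{D}_i([f,c])\big]$$ over all conditional domain discriminators $\mathcal{D}=(\mathcal{D}_1,\dots,\mathcal{D}_M)$. Then $$\mathcal{J}_{\mathcal{D}^*}=M\log M-\sum_{i=1}^M KL\big(P_i(f,c)\,\|\,\widetilde{P}(f,c)\big).$$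
   Context: There are $M$ domains $D_1,\dots,D_M$, each with a probability distribution of inputs $\mathbf{x}$. A shared feature extractor is a measurable map $\mathcal{F}_s$ from inputs to a Euclidean space; for each domain $i$, a domain-specific feature extractor is a measurable map $\mathcal{F}_d^i$ from inputs to a Euclidean space; a classifier $\mathcal{C}$ maps a concatenated vector $[\mathcal{F}_s(\mathbf{x}),\mathcal{F}_d^i(\mathbf{x})]$ to a vector of label probabilities. Here $[\cdot,\cdot]$ denotes concatenation of vectors. Write $\mathcal{C}_i=\mathcal{C}([\mathcal{F}_s(\mathbf{x}),\mathcal{F}_d^i(\mathbf{x})])$ for the label prediction for an input $\mathbf{x}$ of domain $i$. The joint distribution of domain $i$ is $P_i(f,c) \triangleq P(f=\mathcal{F}_s(\mathbf{x}),\, c=\mathcal{C}_i \mid \mathbf{x}\in D_i)$, the law of the pair $(\mathcal{F}_s(\mathbf{x}),\mathcal{C}_i)$ when $\mathbf{x}$ is drawn from domain $i$; $P_i(f,c)$ also denotes its density with respect to a common $\sigma$-finite reference measure (for instance $\sum_j P_j$). A conditional domain discriminator is a measurable map $\mathcal{D}=(\mathcal{D}_1,\dots,\mathcal{D}_M)$ with $\mathcal{D}_i([f,c])\ge 0$ and $\sum_{i=1}^M\mathcal{D}_i([f,c])=1$; $\mathcal{D}_i([f,c])$ is the probability it assigns to $[f,c]$ coming from the $i$-th domain. $\log$ is the natural logarithm, with $-\log 0=+\infty$. $KL(P\|Q)=\mathbb{E}_{(f,c)\sim P}\big[\log\frac{P(f,c)}{Q(f,c)}\big]$ is the Kullback-Leibler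 divergence. *)

theory Defs
  imports "HOL-Probability.Probability"
begin

definition vec_concat :: "real ^ 'm \<Rightarrow> real ^ 'n \<Rightarrow> real ^ ('m + 'n)" where
  "vec_concat u v = (\<chi> k. case k of Inl i \<Rightarrow> u $ i | Inr j \<Rightarrow> v $ j)"

definition prob_vector :: "real ^ 'l \<Rightarrow> bool" where
  "prob_vector u \<longleftrightarrow> (\<forall>l. 0 \<le> u $ l) \<and> (\<Sum>l\<in>UNIV. u $ l) = 1"

definition label_prediction ::
  "('x \<Rightarrow> real ^ 'f) \<Rightarrow> (nat \<Rightarrow> 'x \<Rightarrow> real ^ 'd) \<Rightarrow> (real ^ ('f + 'd) \<Rightarrow> real ^ 'l) \<Rightarrow> nat \<Rightarrow> 'x \<Rightarrow> real ^ 'l"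
  where "label_prediction Fs Fd C i x = C (vec_concat (Fs x) (Fd i x))"

text \<open>The law of the pair (shared feature, label prediction) when the input is drawn from
  domain \<open>i\<close>, whose input distribution is \<open>X i\<close>.\<close>

definition joint_distribution ::
  "(nat \<Rightarrow> 'x measure) \<Rightarrow> ('x \<Rightarrow> real ^ 'f) \<Rightarrow> (nat \<Rightarrow> 'x \<Rightarrow> real ^ 'd) \<Rightarrow> (real ^ ('f + 'd) \<Rightarrow> real ^ 'l)
    \<Rightarrow> nat \<Rightarrow> ((real ^ 'f) \<times> (real ^ 'l)) measure"
  where "joint_distribution X Fs Fd C i =
    distr (X i) borel (\<lambda>x. (Fs x, label_prediction Fs Fd C i x))"

definition mixture_density :: "nat \<Rightarrow> (nat \<Rightarrow> 'z \<Rightarrow> real) \<Rightarrow> 'z \<Rightarrow> real" where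
  "mixture_density M p z = (\<Sum>i = 1..M. p i z) / real M"

definition cond_discriminator :: "nat \<Rightarrow> (nat \<Rightarrow> real ^ 'k \<Rightarrow> real) \<Rightarrow> bool" where
  "cond_discriminator M D \<longleftrightarrow>
    (\<forall>i\<in>{1..M}. D i \<in> borel_measurable borel \<and> (\<forall>v. 0 \<le> D i v)) \<and>
    (\<forall>v. (\<Sum>i = 1..M. D i v) = 1)"

text \<open>Negative natural logarithm on \<open>[0, 1]\<close>, with \<open>- log 0 = \<infinity>\<close>
  (the library function has \<open>ln 0 = 0\<close>). Discriminator values lie in \<open>[0, 1]\<close>,
  so the coercion to \<^typ>\<open>ennreal\<close> does not truncate.\<close>

definition neg_log :: "real \<Rightarrow> ennreal" where
  "neg_log q = (if q = 0 then \<infinity> else ennreal (- ln q))"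

text \<open>The summands are nonnegative, so each expectation of \<open>- log\<close> is a
  nonnegative integral that may be infinite.\<close>

definition disc_loss ::
  "nat \<Rightarrow> (nat \<Rightarrow> ((real ^ 'f) \<times> (real ^ 'l)) measure) \<Rightarrow> (nat \<Rightarrow> real ^ ('f + 'l) \<Rightarrow> real) \<Rightarrow> ereal"
  where "disc_loss M P D =
    (\<Sum>i = 1..M. enn2ereal (\<integral>\<^sup>+ (f, c). neg_log (D i (vec_concat f c)) \<partial>P i))"

definition optimal_discriminator ::
  "nat \<Rightarrow> (nat \<Rightarrow> ((real ^ 'f) \<times> (real ^ 'l)) measure) \<Rightarrow> (nat \<Rightarrow> real ^ ('f + 'l) \<Rightarrow> real) \<Rightarrow> bool"
  where "optimal_discriminator M P D \<longleftrightarrow>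
    cond_discriminator M D \<and> (\<forall>D'. cond_discriminator M D' \<longrightarrow> disc_loss M P D \<le> disc_loss M P D')"

text \<open>\<^const>\<open>KL_divergence\<close> takes the base of the logarithm first and the measures in reversed order:
  \<open>KL_divergence b Q P\<close> is the \<open>P\<close>-expectation of \<open>log b (dP/dQ)\<close>.\<close>

abbreviation KL :: "'z measure \<Rightarrow> 'z measure \<Rightarrow> real" where
  "KL P Q \<equiv> KL_divergence (exp 1) Q P"

end

theory Submission
  imports Defs
begin

text \<open>With \<open>s = \<Sum>i. p i\<close>, Gibbs' inequality applied pointwise in \<open>z\<close> to the weights
  \<open>p i z\<close> shows that the discriminator \<open>D i = p i / s\<close> minimizes the integrand of the loss at every
  point, so its loss is the minimal one. Since \<open>p i / s\<close> differs from the density ratio of \<open>P i\<close>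
  to the mixture only by the factor \<open>M\<close>, and \<open>- x * ln x \<le> 1\<close> makes all integrals finite,
  the minimal loss splits into \<open>M * ln M\<close> and the divergences.\<close>

section \<open>Concatenated vectors and their components\<close>

text \<open>A discriminator sees only the concatenated vector. Splitting it recovers the pair
  \<open>(f, c)\<close>, so that the densities can be evaluated there when the optimal discriminator
  is built.\<close>

definition vec_split :: "real ^ ('m + 'n) \<Rightarrow> (real ^ 'm) \<times> (real ^ 'n)" where
  "vec_split v = ((\<chi> i. v $ Inl i), (\<chi> j. v $ Inr j))"

lemma vec_split_concat [simp]: "vec_split (vec_concat u v) = (u, v)"
  by (simp add: vec_split_def vec_concat_def vec_eq_iff)

lemma borel_measurable_vec_split [measurable]: "vec_split \<in> borel \<rightarrow>\<^sub>M borel"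
  unfolding vec_split_def
  by (intro borel_measurable_continuous_onI continuous_intros)

lemma borel_measurable_vec_concat:
  "(\<lambda>z. vec_concat (fst z) (snd z)) \<in> borel \<rightarrow>\<^sub>M borel"
proof (rule borel_measurable_continuous_onI)
  have "continuous_on UNIV (\<lambda>z :: (real ^ 'm) \<times> (real ^ 'n).
      case k of Inl i \<Rightarrow> fst z $ i | Inr j \<Rightarrow> snd z $ j)" for k :: "'m::finite + 'n::finite"
    by (cases k) (auto intro!: continuous_intros)
  then show "continuous_on UNIV (\<lambda>z :: (real ^ 'm) \<times> (real ^ 'n). vec_concat (fst z) (snd z))"
    unfolding vec_concat_def by (rule continuous_on_vec_lambda)
qed

section \<open>Weighted logarithms and Gibbs' inequality\<close>

lemma borel_measurable_neg_log [measurable]: "neg_log \<in> borel_measurable borel"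
  unfolding neg_log_def by measurable

text \<open>For \<open>a = 0\<close> both sides vanish, even at \<open>q = 0\<close>, because 0
  times infinity is 0 in \<open>ennreal\<close>. The last premise rules out the one infinite
  product, a positive weight at \<open>q = 0\<close>.\<close>

lemma ennreal_mult_neg_log:
  assumes "0 \<le> a" "0 \<le> q" "q \<le> 1" "0 < a \<Longrightarrow> 0 < q"
  shows "ennreal a * neg_log q = ennreal (a * - ln q)"
proof (cases "a = 0")
  case False
  with assms have "0 < a" "0 < q" by auto
  with assms show ?thesis by (simp add: neg_log_def flip: ennreal_mult')
qed simp

lemma share_bounds:
  fixes a :: "'i \<Rightarrow> real"
  assumes "finite I" "\<And>j. j \<in> I \<Longrightarrow> 0 \<le> a j" "i \<in> I"
  shows "0 \<le> a i / sum a I" "a i / sum a I \<le> 1" "0 < a i \<Longrightarrow> 0 < a i / sum a I"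
proof -
  have le: "a i \<le> sum a I" using assms by (intro member_le_sum) auto
  have "0 \<le> a i" using assms by auto
  with le show "0 \<le> a i / sum a I" "a i / sum a I \<le> 1" "0 < a i \<Longrightarrow> 0 < a i / sum a I"
    by (auto simp: divide_le_eq_1 intro!: divide_nonneg_nonneg divide_pos_pos)
qed

text \<open>The weights are not normalised, since the densities of the domains at one point need not
  sum to 1. A positive weight with \<open>d i = 0\<close> makes the right-hand side infinite;
  otherwise all terms are real and a tangent bound on \<open>ln\<close> settles the
  comparison.\<close>

lemma gibbs_neg_log:
  fixes a d :: "'i \<Rightarrow> real"
  assumes I: "finite I" and a: "\<And>i. i \<in> I \<Longrightarrow> 0 \<le> a i"
    and d: "\<And>i. i \<in> I \<Longrightarrow> 0 \<le> d i" "sum d I = 1"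
  shows "(\<Sum>i\<in>I. ennreal (a i) * neg_log (a i / sum a I)) \<le> (\<Sum>i\<in>I. ennreal (a i) * neg_log (d i))"
proof (cases "\<exists>i\<in>I. 0 < a i \<and> d i = 0")
  case True
  then obtain i where i: "i \<in> I" "0 < a i" "d i = 0" by auto
  then have "ennreal (a i) * neg_log (d i) = \<infinity>"
    by (simp add: neg_log_def ennreal_mult_top)
  moreover have "ennreal (a i) * neg_log (d i) \<le> (\<Sum>i\<in>I. ennreal (a i) * neg_log (d i))"
    using I i by (intro member_le_sum) auto
  ultimately show ?thesis by (simp add: top_unique)
next
  case False
  then have dpos: "0 < d i" if "i \<in> I" "0 < a i" for i
    using that d(1)[of i] by (cases "d i = 0") auto
  have d1: "d i \<le> 1" if "i \<in> I" for i
    using member_le_sum[OF that, of d] I d by auto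
  note share = share_bounds[of I a, OF I a]
  have d': "ennreal (a i) * neg_log (d i) = ennreal (a i * - ln (d i))" "0 \<le> a i * - ln (d i)"
    if i: "i \<in> I" for i
  proof -
    show "ennreal (a i) * neg_log (d i) = ennreal (a i * - ln (d i))"
      using i a d d1 dpos by (intro ennreal_mult_neg_log) auto
    show "0 \<le> a i * - ln (d i)"
      using i a[OF i] d1 dpos by (cases "a i = 0") (auto simp: mult_le_0_iff ln_le_zero_iff)
  qed
  have a': "ennreal (a i) * neg_log (a i / sum a I) = ennreal (a i * - ln (a i / sum a I))"
    "0 \<le> a i * - ln (a i / sum a I)" if i: "i \<in> I" for i
  proof -
    show "ennreal (a i) * neg_log (a i / sum a I) = ennreal (a i * - ln (a i / sum a I))"
      using i a share by (intro ennreal_mult_neg_log) auto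
    show "0 \<le> a i * - ln (a i / sum a I)"
    proof (cases "a i = 0")
      case False
      then have "0 < a i" using a[OF i] by auto
      then have "ln (a i / sum a I) \<le> 0"
        using share[OF _ i] by (subst ln_le_zero_iff) auto
      with \<open>0 < a i\<close> show ?thesis by (simp add: mult_le_0_iff)
    qed simp
  qed
  \<comment> \<open>The slack \<open>sum a I * d i - a i\<close> comes from
    \<open>ln x \<le> x - 1\<close> at \<open>x = d i * sum a I / a i\<close>, the ratio of
    \<open>d i\<close> to the share of \<open>i\<close>. Over \<open>I\<close> the slacks add up to
    0, because \<open>d\<close> sums to 1.\<close>
  have "a i * - ln (a i / sum a I) \<le> a i * - ln (d i) + (sum a I * d i - a i)" if i: "i \<in> I" for i
  proof (cases "a i = 0")
    case True
    with i a d show ?thesis by (simp add: sum_nonneg)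
  next
    case False
    then have ai: "0 < a i" using a[OF i] by auto
    have s: "0 < sum a I"
      using ai member_le_sum[OF i, of a] I a by auto
    have di: "0 < d i" using dpos i ai by auto
    have "ln (d i * sum a I / a i) \<le> d i * sum a I / a i - 1"
      using ai s di by (intro ln_le_minus_one) auto
    then have "a i * (ln (d i) + ln (sum a I) - ln (a i)) \<le> a i * (d i * sum a I / a i - 1)"
      using ai s di by (intro mult_left_mono) (auto simp: ln_div ln_mult)
    then show ?thesis using ai s di by (simp add: ln_div algebra_simps)
  qed
  then have "(\<Sum>i\<in>I. a i * - ln (a i / sum a I)) \<le> (\<Sum>i\<in>I. a i * - ln (d i) + (sum a I * d i - a i))"
    by (rule sum_mono)
  also have "\<dots> = (\<Sum>i\<in>I. a i * - ln (d i))"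
    using d(2) by (simp add: sum.distrib sum_subtractf sum_negf flip: sum_distrib_left)
  finally have "ennreal (\<Sum>i\<in>I. a i * - ln (a i / sum a I)) \<le> ennreal (\<Sum>i\<in>I. a i * - ln (d i))"
    by (rule ennreal_leI)
  then show ?thesis
    using a' d' by (simp only: sum_ennreal cong: sum.cong)
qed

text \<open>Multiplying \<open>ln (s / a) \<le> s / a - 1\<close> by \<open>a\<close> gives the
  bound \<open>s - a\<close>. This makes the sum of the densities an integrable majorant for the
  divergence integrands.\<close>

lemma abs_mult_ln_share_le:
  fixes a s :: real
  assumes "0 \<le> a" "a \<le> s"
  shows "\<bar>a * ln (a / s)\<bar> \<le> s"
proof (cases "a = 0")
  case False
  with assms have a: "0 < a" "0 < s" by auto
  have "ln (s / a) \<le> s / a - 1" using a by (intro ln_le_minus_one) auto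
  then have "a * ln (s / a) \<le> a * (s / a - 1)" using a by (intro mult_left_mono) auto
  also have "\<dots> \<le> s" using a by (simp add: algebra_simps)
  finally have "a * ln (s / a) \<le> s" .
  moreover have "ln (a / s) = - ln (s / a)" using a by (simp add: ln_div)
  moreover have "0 \<le> ln (s / a)" using a assms by (simp add: ln_ge_zero_iff)
  ultimately show ?thesis using a by (simp add: abs_mult)
qed (use assms in simp)

theorem theorem1:
  fixes M :: nat
    and S :: "'x measure"
    and X :: "nat \<Rightarrow> 'x measure"
    and Fs :: "'x \<Rightarrow> real ^ 'f"
    and Fd :: "nat \<Rightarrow> 'x \<Rightarrow> real ^ 'd"
    and C :: "real ^ ('f + 'd) \<Rightarrow> real ^ 'l"
    and P :: "nat \<Rightarrow> ((real ^ 'f) \<times> (real ^ 'l)) measure"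
    and \<mu> :: "((real ^ 'f) \<times> (real ^ 'l)) measure"
    and p :: "nat \<Rightarrow> (real ^ 'f) \<times> (real ^ 'l) \<Rightarrow> real"
    and Dstar :: "nat \<Rightarrow> real ^ ('f + 'l) \<Rightarrow> real"
  assumes "1 \<le> M"
    and "\<And>i. i \<in> {1..M} \<Longrightarrow> prob_space (X i)"
    and "\<And>i. i \<in> {1..M} \<Longrightarrow> sets (X i) = sets S"
    and "Fs \<in> S \<rightarrow>\<^sub>M borel"
    and "\<And>i. i \<in> {1..M} \<Longrightarrow> Fd i \<in> S \<rightarrow>\<^sub>M borel"
    and "C \<in> borel \<rightarrow>\<^sub>M borel"
    and "\<And>u. prob_vector (C u)"
    and "\<And>i. i \<in> {1..M} \<Longrightarrow> P i = joint_distribution X Fs Fd C i"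
    and "sigma_finite_measure \<mu>" and "sets \<mu> = sets borel"
    and "\<And>i. i \<in> {1..M} \<Longrightarrow> p i \<in> borel_measurable \<mu>"
    and "\<And>i z. i \<in> {1..M} \<Longrightarrow> 0 \<le> p i z"
    and "\<And>i. i \<in> {1..M} \<Longrightarrow> P i = density \<mu> (\<lambda>z. ennreal (p i z))"
    and "optimal_discriminator M P Dstar"
  shows "disc_loss M P Dstar =
    ereal (real M * ln (real M)
      - (\<Sum>i = 1..M. KL (P i) (density \<mu> (\<lambda>z. ennreal (mixture_density M p z)))))"
proof -
  define I where "I = {1..M}"
  define s where "s z = (\<Sum>i\<in>I. p i z)" for z
  \<comment> \<open>The divergence integrand relative to the unnormalised sum \<open>s\<close>;
    passing to the mixture \<open>s / M\<close> later adds \<open>p i z * ln M\<close>.\<close>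
  define h where "h i z = p i z * ln (p i z / s z)" for i z
  interpret \<mu>: sigma_finite_measure \<mu> by fact
  note [measurable_cong] = \<open>sets \<mu> = sets borel\<close>
  have I: "finite I" "card I = M" by (auto simp: I_def)
  have p_nonneg: "0 \<le> p i z" if "i \<in> I" for i z using assms(12) that by (simp add: I_def)
  have p_meas: "p i \<in> borel_measurable \<mu>" if "i \<in> I" for i using assms(11) that by (simp add: I_def)
  have p_borel: "p i \<in> borel_measurable borel" if "i \<in> I" for i
    using p_meas[OF that] measurable_cong_sets[OF assms(10) refl] by blast
  have P: "P i = density \<mu> (\<lambda>z. ennreal (p i z))" if "i \<in> I" for i
    using assms(13) that by (simp add: I_def)
  have s_meas: "s \<in> borel_measurable \<mu>" and s_borel: "s \<in> borel_measurable borel"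
    unfolding s_def using p_meas p_borel by (auto intro!: borel_measurable_sum)
  have s_nonneg: "0 \<le> s z" for z unfolding s_def by (intro sum_nonneg p_nonneg)
  have p_le_s: "p i z \<le> s z" if "i \<in> I" for i z
    unfolding s_def using that I p_nonneg by (intro member_le_sum) auto
  have concat_meas: "(\<lambda>z. vec_concat (fst z) (snd z)) \<in> \<mu> \<rightarrow>\<^sub>M borel"
    using borel_measurable_vec_concat by measurable

  \<comment> \<open>Normalisation and integrability of the densities\<close>
  have total: "(\<integral>\<^sup>+z. ennreal (p i z) \<partial>\<mu>) = 1" if i: "i \<in> I" for i
  proof -
    interpret X: prob_space "X i" using assms(2) i by (simp add: I_def)
    have XS: "sets (X i) = sets S" using assms(3) i by (simp add: I_def)
    have Fs: "Fs \<in> X i \<rightarrow>\<^sub>M borel"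
      using assms(4) measurable_cong_sets[OF XS refl] by blast
    have Fd: "Fd i \<in> X i \<rightarrow>\<^sub>M borel"
      using assms(5) i measurable_cong_sets[OF XS refl] unfolding I_def by blast
    have "(\<lambda>x. C (vec_concat (fst (Fs x, Fd i x)) (snd (Fs x, Fd i x)))) \<in> X i \<rightarrow>\<^sub>M borel"
      by (intro measurable_compose[OF _ assms(6)]
          measurable_compose[OF _ borel_measurable_vec_concat] borel_measurable_Pair Fs Fd)
    then have "(\<lambda>x. (Fs x, label_prediction Fs Fd C i x)) \<in> X i \<rightarrow>\<^sub>M borel"
      unfolding label_prediction_def by (intro borel_measurable_Pair Fs) simp
    \<comment> \<open>That \<open>p i\<close> has integral 1 is not assumed: it follows because
      \<open>P i\<close> is the image of a probability measure under a measurable map.\<close>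
    then have "prob_space (P i)"
      using assms(8) i X.prob_space_distr by (simp add: I_def joint_distribution_def)
    then have "emeasure (P i) (space (P i)) = 1" by (rule prob_space.emeasure_space_1)
    then show ?thesis using p_meas[OF i] by (simp add: P[OF i] emeasure_density cong: nn_integral_cong)
  qed
  have p_int: "integrable \<mu> (p i)" and p_integral: "(\<integral>z. p i z \<partial>\<mu>) = 1" if i: "i \<in> I" for i
  proof -
    have "has_bochner_integral \<mu> (p i) 1"
      using p_meas[OF i] p_nonneg[OF i] total[OF i] by (intro has_bochner_integral_nn_integral) auto
    then show "integrable \<mu> (p i)" "(\<integral>z. p i z \<partial>\<mu>) = 1"
      by (auto simp: has_bochner_integral_iff)
  qed
  have s_int: "integrable \<mu> s" unfolding s_def using p_int by (intro Bochner_Integration.integrable_sum)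
  have h_meas: "h i \<in> borel_measurable \<mu>" if "i \<in> I" for i
    unfolding h_def using p_meas[OF that] s_meas by measurable
  have h_int: "integrable \<mu> (h i)" if i: "i \<in> I" for i
    using s_int h_meas[OF i]
    by (rule Bochner_Integration.integrable_bound)
       (use abs_mult_ln_share_le[OF p_nonneg[OF i] p_le_s[OF i]] s_nonneg in \<open>simp add: h_def\<close>)

  have weighted: "ennreal (p i z) * neg_log (p i z / s z) = ennreal (- h i z)" "0 \<le> - h i z"
    if i: "i \<in> I" for i z
  proof -
    note share = share_bounds[of I "\<lambda>i. p i z", OF I(1) p_nonneg i, folded s_def]
    show "ennreal (p i z) * neg_log (p i z / s z) = ennreal (- h i z)"
      using ennreal_mult_neg_log[OF p_nonneg[OF i] share] by (simp add: h_def)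
    show "0 \<le> - h i z"
    proof (cases "p i z = 0")
      case False
      then have "0 < p i z" using p_nonneg[OF i, of z] by auto
      then have "ln (p i z / s z) \<le> 0" using share by (subst ln_le_zero_iff) auto
      with \<open>0 < p i z\<close> show ?thesis by (simp add: h_def mult_le_0_iff)
    qed (simp add: h_def)
  qed

  \<comment> \<open>The loss as one integral, and its minimizer\<close>
  have loss: "disc_loss M P D =
      enn2ereal (\<integral>\<^sup>+z. (\<Sum>i\<in>I. ennreal (p i z) * neg_log (D i (vec_concat (fst z) (snd z)))) \<partial>\<mu>)"
    if D: "cond_discriminator M D" for D
  proof -
    have Dm: "(\<lambda>z. neg_log (D i (vec_concat (fst z) (snd z)))) \<in> borel_measurable \<mu>" if "i \<in> I" for i
      using D that measurable_compose[OF concat_meas] measurable_compose[OF _ borel_measurable_neg_log]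
      unfolding cond_discriminator_def I_def by blast
    have "(\<integral>\<^sup>+ (f, c). neg_log (D i (vec_concat f c)) \<partial>P i) =
        (\<integral>\<^sup>+z. ennreal (p i z) * neg_log (D i (vec_concat (fst z) (snd z))) \<partial>\<mu>)" if i: "i \<in> I" for i
      using Dm[OF i] p_meas[OF i] by (simp add: P[OF i] case_prod_beta nn_integral_density)
    then have "disc_loss M P D = (\<Sum>i\<in>I. enn2ereal
        (\<integral>\<^sup>+z. ennreal (p i z) * neg_log (D i (vec_concat (fst z) (snd z))) \<partial>\<mu>))"
      unfolding disc_loss_def I_def[symmetric] by (intro sum.cong) auto
    also have "\<dots> = enn2ereal (\<Sum>i\<in>I.
        (\<integral>\<^sup>+z. ennreal (p i z) * neg_log (D i (vec_concat (fst z) (snd z))) \<partial>\<mu>))"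
      by (intro sum_enn2ereal) auto
    \<comment> \<open>With the sum inside a single integral over \<open>\<mu>\<close>, two
      discriminators can be compared pointwise in \<open>z\<close>.\<close>
    also have "\<dots> = enn2ereal (\<integral>\<^sup>+z.
        (\<Sum>i\<in>I. ennreal (p i z) * neg_log (D i (vec_concat (fst z) (snd z)))) \<partial>\<mu>)"
      using Dm p_meas by (subst nn_integral_sum) auto
    finally show ?thesis .
  qed

  \<comment> \<open>Where \<open>s\<close> vanishes, \<open>p i / s\<close> is the junk value 0, and the components would not sum to 1.\<close>
  define D0 where "D0 i v = (if s (vec_split v) = 0 then 1 / real M
      else p i (vec_split v) / s (vec_split v))" for i v
  have "D0 i \<in> borel_measurable borel" if "i \<in> I" for i
    unfolding D0_def using p_borel[OF that] s_borel by measurable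
  moreover have "0 \<le> D0 i v" if "i \<in> I" for i v
    unfolding D0_def using p_nonneg[OF that] s_nonneg by auto
  moreover have "(\<Sum>i\<in>I. D0 i v) = 1" for v
  proof (cases "s (vec_split v) = 0")
    case False
    then show ?thesis by (simp add: D0_def s_def flip: sum_divide_distrib)
  qed (use I assms(1) in \<open>simp add: D0_def\<close>)
  ultimately have D0: "cond_discriminator M D0" by (simp add: cond_discriminator_def I_def)

  \<comment> \<open>Where \<open>s z = 0\<close>, every \<open>p i z\<close> is 0 as well, so the
    value \<open>1 / M\<close> chosen there contributes nothing.\<close>
  have "ennreal (p i z) * neg_log (D0 i (vec_concat (fst z) (snd z))) = ennreal (- h i z)"
    if i: "i \<in> I" for i z
    using weighted(1)[OF i, of z] p_le_s[OF i, of z] p_nonneg[OF i, of z]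
    by (cases "s z = 0") (auto simp: D0_def h_def)
  then have loss_D0: "disc_loss M P D0 = enn2ereal (\<integral>\<^sup>+z. (\<Sum>i\<in>I. ennreal (- h i z)) \<partial>\<mu>)"
    unfolding loss[OF D0] by simp

  have "disc_loss M P D0 \<le> disc_loss M P D" if D: "cond_discriminator M D" for D
  proof -
    have "(\<Sum>i\<in>I. ennreal (- h i z)) \<le>
        (\<Sum>i\<in>I. ennreal (p i z) * neg_log (D i (vec_concat (fst z) (snd z))))" for z
    proof -
      have "(\<Sum>i\<in>I. ennreal (- h i z)) = (\<Sum>i\<in>I. ennreal (p i z) * neg_log (p i z / s z))"
        using weighted(1) by simp
      also have "\<dots> \<le> (\<Sum>i\<in>I. ennreal (p i z) * neg_log (D i (vec_concat (fst z) (snd z))))"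
        unfolding s_def using D I(1) p_nonneg
        by (intro gibbs_neg_log) (auto simp: cond_discriminator_def I_def)
      finally show ?thesis .
    qed
    then show ?thesis
      unfolding loss_D0 loss[OF D] by (simp add: nn_integral_mono flip: less_eq_ennreal.rep_eq)
  qed
  \<comment> \<open>\<open>Dstar\<close> need not coincide with \<open>D0\<close>; both are
    minimizers, so their losses agree, and that is enough.\<close>
  with D0 assms(14) have optimal: "disc_loss M P Dstar = disc_loss M P D0"
    unfolding optimal_discriminator_def by (meson antisym)

  \<comment> \<open>Evaluation of the minimal loss\<close>
  have "(\<integral>\<^sup>+z. (\<Sum>i\<in>I. ennreal (- h i z)) \<partial>\<mu>) = (\<integral>\<^sup>+z. ennreal (\<Sum>i\<in>I. - h i z) \<partial>\<mu>)"
    using weighted(2) by (intro nn_integral_cong) (simp add: sum_ennreal)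
  \<comment> \<open>Integrability of each \<open>h i\<close> makes the minimal loss finite, so it
    becomes a real integral.\<close>
  also have "\<dots> = ennreal (\<integral>z. (\<Sum>i\<in>I. - h i z) \<partial>\<mu>)"
    using h_int weighted(2) by (intro nn_integral_eq_integral) (auto intro!: AE_I2 sum_nonneg)
  finally have "disc_loss M P Dstar = ereal (\<integral>z. (\<Sum>i\<in>I. - h i z) \<partial>\<mu>)"
    unfolding optimal loss_D0 using weighted(2)
    by (simp only: enn2ereal_ennreal Bochner_Integration.integral_nonneg sum_nonneg)
  also have "(\<integral>z. (\<Sum>i\<in>I. - h i z) \<partial>\<mu>) = - (\<Sum>i\<in>I. \<integral>z. h i z \<partial>\<mu>)"
    using h_int by (subst Bochner_Integration.integral_sum) (auto simp: sum_negf)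
  also have "- (\<Sum>i\<in>I. \<integral>z. h i z \<partial>\<mu>) = real M * ln (real M)
      - (\<Sum>i\<in>I. KL (P i) (density \<mu> (\<lambda>z. ennreal (mixture_density M p z))))"
  proof -
    have mix: "mixture_density M p = (\<lambda>z. s z / real M)"
      by (simp add: mixture_density_def s_def I_def fun_eq_iff)
    have "KL (P i) (density \<mu> (\<lambda>z. ennreal (mixture_density M p z))) = (\<integral>z. h i z \<partial>\<mu>) + ln (real M)"
      if i: "i \<in> I" for i
    proof -
      have "KL (P i) (density \<mu> (\<lambda>z. ennreal (mixture_density M p z))) =
          (\<integral>z. p i z * log (exp 1) (p i z / (s z / real M)) \<partial>\<mu>)"
        unfolding P[OF i] mix
      proof (rule \<mu>.KL_density_density)
        \<comment> \<open>Absolute continuity of \<open>P i\<close> with respect to the mixture: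
          \<open>s\<close> dominates \<open>p i\<close>.\<close>
        show "AE z in \<mu>. s z / real M = 0 \<longrightarrow> p i z = 0"
        proof (rule AE_I2, rule impI)
          fix z
          assume "s z / real M = 0"
          then show "p i z = 0" using p_le_s[OF i, of z] p_nonneg[OF i, of z] assms(1) by simp
        qed
      qed (use p_meas[OF i] s_meas p_nonneg[OF i] s_nonneg in auto)
      \<comment> \<open>The density ratio is \<open>M * p i z / s z\<close>, and
        \<open>log (exp 1)\<close> is \<open>ln\<close>. The extra term \<open>p i z * ln M\<close>
        integrates to \<open>ln M\<close>, since \<open>p i\<close> has total mass 1.\<close>
      also have "\<dots> = (\<integral>z. h i z + p i z * ln (real M) \<partial>\<mu>)"
      proof (intro Bochner_Integration.integral_cong refl)
        fix z
        show "p i z * log (exp 1) (p i z / (s z / real M)) = h i z + p i z * ln (real M)"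
        proof (cases "p i z = 0")
          case False
          then have "0 < p i z" "0 < s z"
            using p_nonneg[OF i, of z] p_le_s[OF i, of z] by auto
          then show ?thesis
            using assms(1) by (simp add: h_def log_def ln_div ln_mult algebra_simps)
        qed (simp add: h_def)
      qed
      also have "\<dots> = (\<integral>z. h i z \<partial>\<mu>) + ln (real M)"
        using h_int[OF i] p_int[OF i] p_integral[OF i] by simp
      finally show ?thesis .
    qed
    \<comment> \<open>Each of the \<open>M\<close> domains contributes one \<open>ln M\<close>,
      which gives \<open>M * ln M\<close>.\<close>
    then show ?thesis using I by (simp add: sum.distrib)
  qed
  finally show ?thesis by (simp add: I_def)
qed

end
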